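(* Let $m,k\in\mathbb{N}$ with $1\le k<2m$, and let $a>0$. For $n\ge 0$ let $r_{m,k}(n)=\#\{(x_1,\dots,x_k)\in\mathbb{Z}^k : x_1^{2m}+\cdots+x_k^{2m}=n\}$, and for $z>0$ let $U_{2m}(z)=\sum_{t\in\mathbb{Z}}\frac{1}{t^{2m}+z^{2m}}$. Then \[ \sum_{n=0}^{\infty}\frac{r_{m,k}(n)}{n+a}\;\ge\;a^{\,k-1}\left[U_{2m}\!\left(a^{1/(2m)}\right)\right]^k. \]
   Context: $\mathbb{N}$ denotes the positive integers. $r_{m,k}(n)$ counts representations of $n$ as a sum of $k$ $(2m)$-th powers of integers (signs and order counted). $U_{2m}$ is called the generalized cotangent series. *)

theory Defs
  imports "HOL-Analysis.Analysis"
begin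

definition rep_count :: "nat \<Rightarrow> nat \<Rightarrow> nat \<Rightarrow> nat" where
  "rep_count m k n =
     card {xs :: int list. length xs = k \<and> (\<Sum>x\<leftarrow>xs. x ^ (2 * m)) = int n}"

definition gen_cot_series :: "nat \<Rightarrow> real \<Rightarrow> real" where
  "gen_cot_series q z = (\<Sum>\<^sub>\<infinity>t::int. 1 / (of_int t ^ q + z ^ q))"

text \<open>
  Both \<^const>\<open>card\<close> and the infinite sum are totalised in HOL (value 0 on infinite sets and
  non-summable families). The following two facts show that these default values are never used
  for positive \<open>m\<close> and \<open>z\<close>.
\<close>

lemma finite_rep_count:
  assumes "m \<ge> 1"
  shows "finite {xs :: int list. length xs = k \<and> (\<Sum>x\<leftarrow>xs. x ^ (2 * m)) = int n}"
proof (rule finite_subset)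
  show "finite {xs :: int list. set xs \<subseteq> {- int n..int n} \<and> length xs = k}"
    by (rule finite_lists_length_eq) simp
  show "{xs :: int list. length xs = k \<and> (\<Sum>x\<leftarrow>xs. x ^ (2 * m)) = int n}
          \<subseteq> {xs. set xs \<subseteq> {- int n..int n} \<and> length xs = k}"
  proof safe
    fix xs :: "int list" and x
    assume s: "(\<Sum>x\<leftarrow>xs. x ^ (2 * m)) = int n" and x: "x \<in> set xs"
    have "x ^ (2 * m) \<le> (\<Sum>x\<leftarrow>xs. x ^ (2 * m))"
      by (rule member_le_sum_list) (use x in \<open>auto simp: power_mult\<close>)
    moreover have "\<bar>x\<bar> \<le> x ^ (2 * m)"
    proof (cases "x = 0")
      case False
      then have "\<bar>x\<bar> ^ 1 \<le> \<bar>x\<bar> ^ (2 * m)"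
        using assms by (intro power_increasing) auto
      then show ?thesis by (simp add: power_even_abs)
    qed auto
    ultimately show "x \<in> {- int n..int n}" using s by auto
  qed
qed

lemma summable_gen_cot_series:
  fixes z :: real
  assumes "m \<ge> 1" "z > 0"
  shows "(\<lambda>t::int. 1 / (of_int t ^ (2 * m) + z ^ (2 * m))) summable_on UNIV"
proof -
  define f where "f = (\<lambda>t::int. 1 / (of_int t ^ (2 * m) + z ^ (2 * m)))"
  have nn: "f t \<ge> 0" for t
    using assms unfolding f_def by (simp add: power_mult)
  have bound: "f (int n) \<le> 1 / real n ^ 2" if "n \<ge> 1" for n
  proof -
    have "real n ^ 2 \<le> real n ^ (2 * m)"
      using assms that by (intro power_increasing) auto
    also have "\<dots> \<le> real n ^ (2 * m) + z ^ (2 * m)" using assms by simp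
    finally show ?thesis
      unfolding f_def using that by (intro divide_left_mono mult_pos_pos add_pos_pos)
        (use assms in auto)
  qed
  have "summable (\<lambda>n. f (int n))"
  proof (rule summable_comparison_test)
    show "summable (\<lambda>n. 1 / real n ^ 2)"
      using inverse_power_summable[of 2, where ?'a = real] by (simp add: inverse_eq_divide)
    show "\<exists>N. \<forall>n\<ge>N. norm (f (int n)) \<le> 1 / real n ^ 2"
      using bound nn by (intro exI[of _ 1]) auto
  qed
  then have "(\<lambda>n. f (int n)) summable_on UNIV"
    using nn by (intro summable_nonneg_imp_summable_on) auto
  then have pos: "f summable_on range int"
    by (subst summable_on_reindex) (auto simp: o_def)
  have "f \<circ> uminus = f" by (auto simp: f_def)
  then have neg: "f summable_on uminus ` range int"
    using pos by (subst summable_on_reindex) auto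
  have "f summable_on (range int \<union> uminus ` range int)"
    using pos neg by (rule summable_on_union)
  also have "range int \<union> uminus ` range int = UNIV"
    by (metis (no_types, lifting) UNIV_eq_I UnCI image_eqI int_cases2 rangeI)
  finally show ?thesis unfolding f_def .
qed

end

theory Submission
  imports Defs
begin

text \<open>
  The left-hand side is the sum of \<open>1 / (x\<^sub>1\<^sup>2\<^sup>m + \<dots> + x\<^sub>k\<^sup>2\<^sup>m + a)\<close> over all integer vectors, grouped by
  the value \<open>n\<close> of the form; the right-hand side is the sum of
  \<open>a\<^sup>k\<^sup>-\<^sup>1 / ((x\<^sub>1\<^sup>2\<^sup>m + a) \<dots> (x\<^sub>k\<^sup>2\<^sup>m + a))\<close> over the same vectors. The latter terms are smaller because
  expanding \<open>(y\<^sub>1 + a) \<dots> (y\<^sub>k + a)\<close> with \<open>y\<^sub>i \<ge> 0\<close> gives at least \<open>a\<^sup>k\<^sup>-\<^sup>1 (y\<^sub>1 + \<dots> + y\<^sub>k + a)\<close>.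
  For convergence, \<open>y\<^sub>1 + \<dots> + y\<^sub>k + a\<close> dominates each \<open>y\<^sub>i + a\<close>, hence also their geometric mean, so
  the left-hand side is at most the \<open>k\<close>-th power of the sum of \<open>(t\<^sup>2\<^sup>m + a)\<^sup>-\<^sup>1\<^sup>/\<^sup>k\<close> over the integers
  \<open>t\<close>, which is finite since \<open>2m/k > 1\<close>.
\<close>

text \<open>Splitting a nonempty list into head and tail reduces this to a double sum. Nonnegativity
  of \<open>g\<close> turns convergence of the iterated sum into summability over the
  product.\<close>

lemma has_sum_prod_list:
  fixes g :: "'a \<Rightarrow> real"
  assumes g: "(g has_sum S) UNIV" and nn: "\<And>x. g x \<ge> 0"
  shows "((\<lambda>xs. prod_list (map g xs)) has_sum S ^ k) {xs. length xs = k}"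
proof (induction k)
  case 0
  have "{xs :: 'a list. length xs = 0} = {[]}" by auto
  then show ?case by (auto intro: has_sum_finiteI)
next
  case (Suc k)
  let ?L = "{xs :: 'a list. length xs = k}"
  let ?f = "\<lambda>(x, xs). g x * prod_list (map g xs)"
  have inner: "((\<lambda>xs. ?f (x, xs)) has_sum g x * S ^ k) ?L" for x
    using has_sum_cmult_right[OF Suc.IH, of "g x"] by simp
  have outer: "((\<lambda>x. g x * S ^ k) has_sum S * S ^ k) UNIV"
    by (rule has_sum_cmult_left[OF g])
  have "?f summable_on UNIV \<times> ?L"
    by (rule summable_on_SigmaI[OF inner has_sum_imp_summable[OF outer]])
      (auto intro!: mult_nonneg_nonneg prod_list_nonneg simp: nn)
  then have "(?f has_sum S * S ^ k) (UNIV \<times> ?L)"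
    by (intro has_sum_SigmaI[OF inner outer])
  moreover have "{xs :: 'a list. length xs = Suc k} = (\<lambda>(x, xs). x # xs) ` (UNIV \<times> ?L)"
    by (auto simp: length_Suc_conv image_iff)
  moreover have "inj_on (\<lambda>(x :: 'a, xs). x # xs) (UNIV \<times> ?L)"
    by (auto simp: inj_on_def)
  ultimately show ?case
    by (simp add: has_sum_reindex o_def case_prod_unfold)
qed

lemma power_length_le_prod_list:
  fixes c :: real
  assumes "c \<ge> 0" and "\<And>x. x \<in> set xs \<Longrightarrow> c \<le> f x"
  shows "c ^ length xs \<le> prod_list (map f xs)"
  using assms(2)
proof (induction xs)
  case (Cons x xs)
  then show ?case
    using assms(1) by (auto intro!: mult_mono intro: order.trans)
qed simp

text \<open>In the induction step the two sides compared first differ by \<open>f x * s\<close>,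
  which is nonnegative. The extra factor \<open>a\<close> on the right avoids the exponent
  \<open>length xs - 1\<close>, whose truncation at 0 would break the empty case for
  \<open>a > 1\<close>.\<close>

lemma power_mult_sum_list_le_prod_list:
  fixes a :: real
  assumes "a > 0" and nn: "\<And>x. f x \<ge> 0"
  shows "a ^ length xs * (sum_list (map f xs) + a) \<le> a * prod_list (map (\<lambda>x. f x + a) xs)"
proof (induction xs)
  case (Cons x xs)
  define s where "s = sum_list (map f xs)"
  have s: "s \<ge> 0"
    unfolding s_def by (intro sum_list_nonneg) (auto simp: nn)
  have "a * (f x + s + a) \<le> (f x + a) * (s + a)"
    using s nn[of x] by (simp add: algebra_simps)
  then have "a ^ length xs * (a * (f x + s + a)) \<le> a ^ length xs * ((f x + a) * (s + a))"
    using assms(1) by (intro mult_left_mono) auto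
  also have "\<dots> = (f x + a) * (a ^ length xs * (s + a))" by simp
  also have "\<dots> \<le> (f x + a) * (a * prod_list (map (\<lambda>x. f x + a) xs))"
    using Cons.IH nn[of x] assms(1) unfolding s_def by (intro mult_left_mono) auto
  finally show ?case by (simp add: s_def algebra_simps)
qed simp

lemma prod_list_map_inverse:
  "prod_list (map (\<lambda>x. 1 / f x) xs) = 1 / prod_list (map (f :: _ \<Rightarrow> real) xs)"
  by (induction xs) auto

lemma summable_on_int_even:
  fixes f :: "int \<Rightarrow> real"
  assumes "\<And>t. f t \<ge> 0" and even: "\<And>t. f (- t) = f t" and "summable (\<lambda>n. f (int n))"
  shows "f summable_on UNIV"
proof -
  have "(\<lambda>n. f (int n)) summable_on UNIV"
    using assms by (intro summable_nonneg_imp_summable_on) auto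
  then have pos: "f summable_on range int"
    by (subst summable_on_reindex) (auto simp: o_def)
  have "f \<circ> uminus = f" by (auto simp: even)
  then have neg: "f summable_on uminus ` range int"
    using pos by (subst summable_on_reindex) auto
  have "f summable_on (range int \<union> uminus ` range int)"
    using pos neg by (rule summable_on_union)
  also have "range int \<union> uminus ` range int = UNIV"
    by (metis (no_types, lifting) UNIV_eq_I UnCI image_eqI int_cases2 rangeI)
  finally show ?thesis .
qed

lemma summable_on_powr_even_power:
  fixes a p :: real
  assumes "a > 0" and p: "p > 0" "2 * real m * p > 1"
  shows "(\<lambda>t::int. (of_int t ^ (2 * m) + a) powr - p) summable_on UNIV"
proof (rule summable_on_int_even)
  show "summable (\<lambda>n. (of_int (int n) ^ (2 * m) + a) powr - p)"
  proof (rule summable_comparison_test)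
    show "summable (\<lambda>n. real n powr - (2 * real m * p))"
      using p by (subst summable_real_powr_iff) auto
    \<comment> \<open>The bound fails at \<open>n = 0\<close>, because \<open>0 powr y\<close> is 0
      while the left side is positive.\<close>
    have "(real n ^ (2 * m) + a) powr - p \<le> real n powr - (2 * real m * p)" if "n \<ge> 1" for n
    proof -
      have "(real n ^ (2 * m) + a) powr - p \<le> (real n ^ (2 * m)) powr - p"
        using assms that by (intro powr_mono2') auto
      also have "\<dots> = (real n powr (2 * real m)) powr - p"
        using that by (simp flip: powr_realpow)
      finally show ?thesis by (simp add: powr_powr)
    qed
    then show "\<exists>N. \<forall>n\<ge>N. norm ((of_int (int n) ^ (2 * m) + a) powr - p)
        \<le> real n powr - (2 * real m * p)"
      by (intro exI[of _ 1]) auto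
  qed
qed auto

lemma has_sum_rep_count:
  fixes a :: real
  assumes "m \<ge> 1"
    and S: "((\<lambda>xs. 1 / ((\<Sum>x\<leftarrow>xs. of_int x ^ (2 * m)) + a)) has_sum S) {xs :: int list. length xs = k}"
  shows "((\<lambda>n. real (rep_count m k n) / (real n + a)) has_sum S) UNIV"
proof -
  define F where "F = (\<lambda>xs :: int list. 1 / ((\<Sum>x\<leftarrow>xs. of_int x ^ (2 * m)) + a))"
  define A where "A = (\<lambda>n. {xs :: int list. length xs = k \<and> (\<Sum>x\<leftarrow>xs. x ^ (2 * m)) = int n})"
  have of_int_sum: "(\<Sum>x\<leftarrow>xs. of_int x ^ (2 * m)) = (of_int (\<Sum>x\<leftarrow>xs. x ^ (2 * m)) :: real)"
    for xs :: "int list"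
    by (induction xs) auto
  have nn: "(\<Sum>x\<leftarrow>xs. x ^ (2 * m)) \<ge> 0" for xs :: "int list"
    by (intro sum_list_nonneg) (auto simp: power_mult)
  \<comment> \<open>Each list lies in exactly one fibre \<open>A n\<close>, so tagging it with its
    \<open>n\<close> allows summing fibre by fibre.\<close>
  have "{xs :: int list. length xs = k} = snd ` Sigma UNIV A"
  proof safe
    fix xs :: "int list" assume "k = length xs"
    then have "(nat (\<Sum>x\<leftarrow>xs. x ^ (2 * m)), xs) \<in> Sigma UNIV A"
      using nn[of xs] by (simp add: A_def)
    then show "xs \<in> snd ` Sigma UNIV A" by force
  qed (auto simp: A_def)
  moreover have "inj_on snd (Sigma UNIV A)"
    by (auto simp: inj_on_def A_def)
  ultimately have "((F \<circ> snd) has_sum S) (Sigma UNIV A)"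
    using S by (simp add: has_sum_reindex F_def)
  then show ?thesis
  proof (rule has_sum_SigmaD)
    fix n
    \<comment> \<open>\<open>F\<close> is constant on a fibre, and fibres are finite as
      \<open>m \<ge> 1\<close>, so \<open>card\<close> really counts the terms.\<close>
    have "(\<Sum>xs\<in>A n. F xs) = (\<Sum>xs\<in>A n. 1 / (real n + a))"
      by (intro sum.cong) (auto simp: A_def F_def of_int_sum)
    then show "((\<lambda>xs. (F \<circ> snd) (n, xs)) has_sum real (rep_count m k n) / (real n + a)) (A n)"
      using finite_rep_count[OF assms(1)]
      by (intro has_sum_finiteI) (auto simp: A_def rep_count_def)
  qed
qed

theorem theorem3p1:
  fixes m k :: nat and a :: real
  assumes "1 \<le> m" and "1 \<le> k" and "k < 2 * m" and "a > 0"
  shows "summable (\<lambda>n. real (rep_count m k n) / (real n + a)) \<and>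
    (\<Sum>n. real (rep_count m k n) / (real n + a))
      \<ge> a ^ (k - 1) * gen_cot_series (2 * m) (a powr (1 / (2 * real m))) ^ k"
proof -
  define f where "f = (\<lambda>x::int. real_of_int x ^ (2 * m))"
  define L where "L = {xs :: int list. length xs = k}"
  define F where "F = (\<lambda>xs. 1 / (sum_list (map f xs) + a))"
  have f_nn: "f x \<ge> 0" for x by (simp add: f_def power_mult)
  have sum_nn: "sum_list (map f xs) \<ge> 0" for xs
    by (intro sum_list_nonneg) (auto simp: f_nn)

  define h where "h = (\<lambda>x. (f x + a) powr - (1 / real k))"
  \<comment> \<open>The hypothesis \<open>k < 2 * m\<close> enters here: the terms of
    \<open>h\<close> decay with exponent \<open>2m/k > 1\<close>.\<close>
  have "2 * real m * (1 / real k) > 1"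
  proof -
    have "real k < real (2 * m)" using assms(3) by (simp only: of_nat_less_iff)
    then show ?thesis using assms(2) by simp
  qed
  then have "h summable_on UNIV"
    unfolding h_def f_def using assms by (intro summable_on_powr_even_power) auto
  then have "(\<lambda>xs. prod_list (map h xs)) summable_on L"
    unfolding L_def
    by (rule has_sum_imp_summable[OF has_sum_prod_list[OF has_sum_infsum]]) (simp add: h_def)
  then have "F summable_on L"
  proof (rule summable_on_comparison_test)
    fix xs assume "xs \<in> L"
    then have k: "length xs = k" by (simp add: L_def)
    define s where "s = sum_list (map f xs) + a"
    have s: "s > 0" using sum_nn[of xs] assms by (simp add: s_def)
    \<comment> \<open>Each \<open>f x + a\<close> is at most \<open>s\<close>, and the negative
      exponent reverses this; the \<open>k\<close> equal lower bounds multiply to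
      \<open>1 / s\<close>.\<close>
    have "(s powr - (1 / real k)) ^ length xs \<le> prod_list (map h xs)"
    proof (rule power_length_le_prod_list)
      fix x assume "x \<in> set xs"
      then have "f x \<le> sum_list (map f xs)"
        by (intro member_le_sum_list) (auto simp: f_nn)
      then show "s powr - (1 / real k) \<le> h x"
        unfolding h_def s_def using assms f_nn[of x] by (intro powr_mono2') auto
    qed simp
    also have "(s powr - (1 / real k)) ^ length xs = s powr - 1"
      using s assms k by (simp add: powr_powr flip: powr_realpow)
    finally show "F xs \<le> prod_list (map h xs)"
      using s by (simp add: F_def s_def powr_minus divide_inverse)
    show "0 \<le> F xs" using s by (simp add: F_def s_def)
  qed
  then have F: "(F has_sum infsum F L) L" by (rule has_sum_infsum)
  then have lhs: "(\<lambda>n. real (rep_count m k n) / (real n + a)) sums infsum F L"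
    unfolding F_def L_def f_def by (intro has_sum_imp_sums has_sum_rep_count assms)

  define z where "z = a powr (1 / (2 * real m))"
  define U where "U = gen_cot_series (2 * m) z"
  \<comment> \<open>This turns the terms of the cotangent series into
    \<open>1 / (f x + a)\<close>.\<close>
  have z: "z > 0" "z ^ (2 * m) = a"
    using assms by (auto simp: z_def powr_powr simp flip: powr_realpow)
  have "((\<lambda>x. 1 / (f x + a)) has_sum U) UNIV"
    unfolding U_def gen_cot_series_def f_def
    using has_sum_infsum[OF summable_gen_cot_series[OF assms(1) z(1)]] z(2) by simp
  then have "((\<lambda>xs. prod_list (map (\<lambda>x. 1 / (f x + a)) xs)) has_sum U ^ k) L"
    unfolding L_def using f_nn assms by (intro has_sum_prod_list) (auto intro!: add_nonneg_nonneg)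
  then have "((\<lambda>xs. a ^ (k - 1) * prod_list (map (\<lambda>x. 1 / (f x + a)) xs)) has_sum a ^ (k - 1) * U ^ k) L"
    by (rule has_sum_cmult_right)
  then have "a ^ (k - 1) * U ^ k \<le> infsum F L"
  proof (rule has_sum_mono[OF _ F])
    fix xs assume "xs \<in> L"
    then have k: "length xs = k" by (simp add: L_def)
    define s where "s = sum_list (map f xs) + a"
    define P where "P = prod_list (map (\<lambda>x. f x + a) xs)"
    have s: "s > 0" using sum_nn[of xs] assms by (simp add: s_def)
    \<comment> \<open>Since \<open>k \<ge> 1\<close>, the truncated \<open>k - 1\<close> is a true
      predecessor; the factor \<open>a\<close> is cancelled afterwards.\<close>
    have "a * (a ^ (k - 1) * s) = a ^ length xs * s"
      using assms k by (simp flip: power_Suc mult.assoc)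
    also have "\<dots> \<le> a * P"
      unfolding s_def P_def by (intro power_mult_sum_list_le_prod_list assms f_nn)
    finally have le: "a ^ (k - 1) * s \<le> P" using assms by simp
    moreover have "a ^ (k - 1) * s > 0" using assms s by simp
    ultimately have "P > 0" by linarith
    then have "a ^ (k - 1) * (1 / P) \<le> 1 / s"
      using le s by (simp add: field_simps)
    then show "a ^ (k - 1) * prod_list (map (\<lambda>x. 1 / (f x + a)) xs) \<le> F xs"
      by (simp only: prod_list_map_inverse F_def s_def P_def)
  qed
  then show ?thesis
    using lhs by (auto simp: sums_iff U_def z_def)
qed

end
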